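(* Let $p_0,p_1,p_2\ge0$ with $p:=p_0+p_1+p_2\in(0,1]$, and let $$S(t)=\sum_{i=0}^{B(t)}\left[I_{1i}Y_{1i}+I_{0i}(Y_{3i}+Y_{4i})+I_{2i}Y_{2i}\right],\qquad t=0,1,\dots,$$ be the compound binomial process described in the context. Then for every $t=0,1,\dots$: (i) the distribution of $S(t)$ is determined by the Laplace–Stieltjes transform $$\mathbb{E}(e^{-zS(t)})=\left[1-p+p_1\mathbb{E}e^{-zY_{11}}+p_0\mathbb{E}e^{-z(Y_{31}+Y_{41})}+p_2\mathbb{E}e^{-zY_{21}}\right]^t,\qquad z\ge0;$$ (ii) if $\mathbb{E}Y_{k1}<\infty$ for $k=1,2,3,4$, then $\mathbb{E}(S(t))=t\left[p_1\mathbb{E}Y_{11}+p_0(\mathbb{E}Y_{31}+\mathbb{E}Y_{41})+p_2\mathbb{E}Y_{21}\right]$; (iii) if $\mathbb{E}(Y_{k1}^2)<\infty$ for $k=1,2,3,4$, then $$\mathbb{D}(S(t))=t\left\{p_1\mathbb{E}(Y_{11}^2)+p_2\mathbb{E}(Y_{21}^2)+p_0\mathbb{E}[(Y_{31}+Y_{41})^2]-\left[p_1\mathbb{E}Y_{11}+p_0(\mathbb{E}Y_{31}+\mathbb{E}Y_{41})+p_2\mathbb{E}Y_{21}\right]^2\right\}.$$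
   Context: $\mathbb{D}$ denotes variance. $B$ is a homogeneous Binomial process with parameter $p$: $B(0)=0$, independent stationary increments, and $B(t)$ is Binomial$(t,p)$. The vectors $(I_{1i},I_{2i},I_{0i})$, $i\ge1$, are i.i.d. and take the values $(1,0,0),(0,1,0),(0,0,1)$ with probabilities $\frac{p_1}{p},\frac{p_2}{p},\frac{p_0}{p}$ respectively. The claim sizes $Y_{ki}$ ($k=1,2,3,4$, $i\ge1$) are integer-valued with $\mathbb{P}(Y_{ki}>0)=1$; $\{Y_{1i}\}_{i\ge1}$ are i.i.d., $\{Y_{2i}\}_{i\ge1}$ are i.i.d., and the pairs $\{(Y_{3i},Y_{4i})\}_{i\ge1}$ are i.i.d. ($Y_{3i}$ and $Y_{4i}$ may be dependent). The families $B$, $\{(I_{1i},I_{2i},I_{0i})\}$, $\{Y_{1i}\}$, $\{Y_{2i}\}$, $\{(Y_{3i},Y_{4i})\}$ are mutually independent. The $i=0$ term of the sum is $0$. *)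

theory Defs
  imports "HOL-Probability.Probability"
begin

context prob_space
begin

definition iid_vars :: "'b measure \<Rightarrow> ('i \<Rightarrow> 'a \<Rightarrow> 'b) \<Rightarrow> 'i set \<Rightarrow> bool" where
  "iid_vars N X T \<longleftrightarrow>
     indep_vars (\<lambda>_. N) X T \<and> (\<forall>i\<in>T. \<forall>j\<in>T. distr M N (X i) = distr M N (X j))"

definition gen_events :: "'b measure \<Rightarrow> ('i \<Rightarrow> 'a \<Rightarrow> 'b) \<Rightarrow> 'i set \<Rightarrow> 'a set set" where
  "gen_events N X T = sigma_sets (space M) (\<Union>i\<in>T. {X i -` A \<inter> space M | A. A \<in> sets N})"

text \<open>Increments are taken in \<^typ>\<open>int\<close>, because subtraction on \<^typ>\<open>nat\<close> truncates.\<close>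

definition binomial_process :: "real \<Rightarrow> (nat \<Rightarrow> 'a \<Rightarrow> nat) \<Rightarrow> bool" where
  "binomial_process p B \<longleftrightarrow>
     (\<forall>t. random_variable (count_space UNIV) (B t)) \<and>
     (AE \<omega> in M. B 0 \<omega> = 0) \<and>
     (\<forall>n \<tau>. strict_mono_on {..n} \<tau> \<longrightarrow>
        indep_vars (\<lambda>_. count_space UNIV)
          (\<lambda>k \<omega>. int (B (\<tau> (Suc k)) \<omega>) - int (B (\<tau> k) \<omega>)) {..<n}) \<and>
     (\<forall>s h. distr M (count_space UNIV) (\<lambda>\<omega>. int (B (s + h) \<omega>) - int (B s \<omega>)) =
            distr M (count_space UNIV) (\<lambda>\<omega>. int (B h \<omega>) - int (B 0 \<omega>))) \<and>
     (\<forall>t. distr M (count_space UNIV) (B t) = measure_pmf (binomial_pmf t p))"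

end

text \<open>
  The families are indexed by \<open>i \<ge> 1\<close>; the values at \<open>i = 0\<close> are arbitrary and unused.
  \<open>I k i\<close> is meant for \<open>k \<in> {0, 1, 2}\<close> and \<open>Y k i\<close> for \<open>k \<in> {1, 2, 3, 4}\<close>.
  The five families have values in different types, so their mutual independence is
  expressed through the \<open>\<sigma>\<close>-algebras they generate.
\<close>

locale compound_binomial_model = prob_space M
  for M :: "'a measure" +
  fixes p0 p1 p2 :: real
    and B :: "nat \<Rightarrow> 'a \<Rightarrow> nat"
    and I Y :: "nat \<Rightarrow> nat \<Rightarrow> 'a \<Rightarrow> int"
  assumes p_nonneg: "0 \<le> p0" "0 \<le> p1" "0 \<le> p2"
    and p_range: "p0 + p1 + p2 \<in> {0<..1}"
    and B: "binomial_process (p0 + p1 + p2) B"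
    and I_iid: "iid_vars (count_space UNIV) (\<lambda>i \<omega>. (I 1 i \<omega>, I 2 i \<omega>, I 0 i \<omega>)) {1..}"
    and I_prob: "\<And>i. i \<ge> 1 \<Longrightarrow>
           prob {\<omega> \<in> space M. (I 1 i \<omega>, I 2 i \<omega>, I 0 i \<omega>) = (1, 0, 0)} = p1 / (p0 + p1 + p2) \<and>
           prob {\<omega> \<in> space M. (I 1 i \<omega>, I 2 i \<omega>, I 0 i \<omega>) = (0, 1, 0)} = p2 / (p0 + p1 + p2) \<and>
           prob {\<omega> \<in> space M. (I 1 i \<omega>, I 2 i \<omega>, I 0 i \<omega>) = (0, 0, 1)} = p0 / (p0 + p1 + p2)"
    and Y_pos: "\<And>k i. k \<in> {1, 2, 3, 4} \<Longrightarrow> i \<ge> 1 \<Longrightarrow> prob {\<omega> \<in> space M. Y k i \<omega> > 0} = 1"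
    and Y1_iid: "iid_vars (count_space UNIV) (Y 1) {1..}"
    and Y2_iid: "iid_vars (count_space UNIV) (Y 2) {1..}"
    and Y34_iid: "iid_vars (count_space UNIV) (\<lambda>i \<omega>. (Y 3 i \<omega>, Y 4 i \<omega>)) {1..}"
    and families_indep: "indep_sets (\<lambda>j::nat.
           [gen_events (count_space UNIV) B UNIV,
            gen_events (count_space UNIV) (\<lambda>i \<omega>. (I 1 i \<omega>, I 2 i \<omega>, I 0 i \<omega>)) {1..},
            gen_events (count_space UNIV) (Y 1) {1..},
            gen_events (count_space UNIV) (Y 2) {1..},
            gen_events (count_space UNIV) (\<lambda>i \<omega>. (Y 3 i \<omega>, Y 4 i \<omega>)) {1..}] ! j) {..<5}"

definition compound_sum ::
    "(nat \<Rightarrow> 'a \<Rightarrow> nat) \<Rightarrow> (nat \<Rightarrow> nat \<Rightarrow> 'a \<Rightarrow> int) \<Rightarrow> (nat \<Rightarrow> nat \<Rightarrow> 'a \<Rightarrow> int) \<Rightarrow> nat \<Rightarrow> 'a \<Rightarrow> int" where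
  "compound_sum B I Y t \<omega> =
     (\<Sum>i=0..B t \<omega>. if i = 0 then 0
        else I 1 i \<omega> * Y 1 i \<omega> + I 0 i \<omega> * (Y 3 i \<omega> + Y 4 i \<omega>) + I 2 i \<omega> * Y 2 i \<omega>)"

definition laplace_stieltjes :: "real measure \<Rightarrow> real \<Rightarrow> real" where
  "laplace_stieltjes N z = (\<integral>x. exp (- z * x) \<partial>N)"

text \<open>
  \<open>L\<close> determines \<open>N\<close>: among the probability distributions on the half-line \<open>[0, \<infinity>)\<close>,
  \<open>N\<close> is the only one whose Laplace-Stieltjes transform is \<open>L\<close>.
\<close>

definition determined_by_lst :: "real measure \<Rightarrow> (real \<Rightarrow> real) \<Rightarrow> bool" where
  "determined_by_lst N L \<longleftrightarrow>
     (\<forall>N'. (prob_space N' \<and> sets N' = sets borel \<and> (AE x in N'. 0 \<le> x) \<and>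
            (\<forall>z\<ge>0. laplace_stieltjes N' z = L z)) \<longleftrightarrow> N' = N)"

end

theory Submission
  imports Defs
begin

text \<open>Almost surely \<open>S(t)\<close> is a sum of \<open>B(t)\<close> i.i.d. claims that are independent of the binomial
  variable \<open>B(t)\<close>; the law of a single claim is the mixture of the laws of \<open>Y\<^sub>1\<close>, \<open>Y\<^sub>2\<close> and
  \<open>Y\<^sub>3 + Y\<^sub>4\<close> with weights \<open>p\<^sub>1/p\<close>, \<open>p\<^sub>2/p\<close>, \<open>p\<^sub>0/p\<close>. Conditioning on \<open>B(t) = n\<close> reduces all three
  formulas to the binomial theorem and the first two binomial moments. That the transform
  determines the law follows from Weierstrass approximation after the substitution \<open>u = exp (- x)\<close>.\<close>

section \<open>Uniqueness of the Laplace-Stieltjes transform\<close>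

text \<open>Polynomials approximate uniformly only on compact sets, so moments are compared on the
  unit interval and not on the half-line; the substitution turns the exponentials with natural
  exponent into monomials there. The main obstacle is independence, which is given on two levels:
  inside each family, and between the five generated sigma-algebras. Conditioning on the count needs
  instead one independent sequence of real variables that holds \<open>B t\<close> and all claims.
  The bridge is a doubly indexed, jointly independent family: claim \<open>i\<close> reads only the
  block with index \<open>i\<close>, \<open>B t\<close> has a block of its own, and functions of
  disjoint blocks are independent. The three formulas share one reduction with a test function
  \<open>g\<close> (exponential, identity, square). Since \<open>B t\<close> is almost surely at
  most \<open>t\<close>, the expectation of \<open>g\<close> of the compound sum is a finite
  binomial mixture and no limit has to be exchanged. The moments of one claim carry a factor
  \<open>1/p\<close>, which cancels against the powers of \<open>p\<close> in the binomial
  weights.\<close>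

lemma unit_interval_distribution_eq_of_moments:
  fixes \<mu> \<nu> :: "real measure"
  assumes "real_distribution \<mu>" "real_distribution \<nu>"
    and \<mu>01: "AE x in \<mu>. x \<in> {0..1}" and \<nu>01: "AE x in \<nu>. x \<in> {0..1}"
    and moments: "\<And>n. (\<integral>x. x ^ n \<partial>\<mu>) = (\<integral>x. x ^ n \<partial>\<nu>)"
  shows "\<mu> = \<nu>"
proof -
  interpret \<mu>: real_distribution \<mu> by fact
  interpret \<nu>: real_distribution \<nu> by fact
  \<comment> \<open>The bound 1 is tailored to cosine and sine, the only functions to which this is
    applied; it makes \<open>f\<close> integrable on the whole line.\<close>
  have cont_eq: "(\<integral>x. f x \<partial>\<mu>) = (\<integral>x. f x \<partial>\<nu>)"
    if f: "continuous_on UNIV f" "\<And>x. \<bar>f x\<bar> \<le> 1" for f :: "real \<Rightarrow> real"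
  proof -
    \<comment> \<open>The factor 2 pays for replacing \<open>f\<close> by the polynomial
      \<open>g\<close> once under each measure; the two integrals of \<open>g\<close> agree because
      they are the same combination of moments.\<close>
    have approx: "\<bar>(\<integral>x. f x \<partial>\<mu>) - (\<integral>x. f x \<partial>\<nu>)\<bar> \<le> 2 * e" if "e > 0" for e
    proof -
      obtain g where g: "real_polynomial_function g" "\<And>x. x \<in> {0..1} \<Longrightarrow> \<bar>f x - g x\<bar> < e"
        using Stone_Weierstrass_real_polynomial_function[of "{0..1}" f e]
          continuous_on_subset[OF f(1)] \<open>e > 0\<close> by (metis compact_Icc subset_UNIV)
      then obtain a m where g_eq: "g = (\<lambda>x. \<Sum>i\<le>m. a i * x ^ i)"
        by (auto simp: real_polynomial_function_iff_sum)
      have close: "integrable \<kappa> g \<and> (\<integral>x. g x \<partial>\<kappa>) = (\<Sum>i\<le>m. a i * (\<integral>x. x ^ i \<partial>\<kappa>)) \<and>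
          \<bar>(\<integral>x. f x \<partial>\<kappa>) - (\<integral>x. g x \<partial>\<kappa>)\<bar> \<le> e"
        if "real_distribution \<kappa>" "AE x in \<kappa>. x \<in> {0..1}" for \<kappa>
      proof -
        interpret real_distribution \<kappa> by fact
        have pow: "integrable \<kappa> (\<lambda>x. x ^ i)" for i
        proof (rule integrable_const_bound[where B = 1])
          show "AE x in \<kappa>. norm (x ^ i) \<le> 1"
            using that(2) by eventually_elim (simp add: power_le_one power_abs)
        qed simp
        then have ig: "integrable \<kappa> g" by (auto simp: g_eq)
        have "f \<in> borel_measurable borel" using f(1) by (rule borel_measurable_continuous_onI)
        then have "integrable \<kappa> f"
          by (intro integrable_const_bound[where B = 1]) (use f(2) in auto)
        with ig have "\<bar>(\<integral>x. f x \<partial>\<kappa>) - (\<integral>x. g x \<partial>\<kappa>)\<bar> = \<bar>\<integral>x. f x - g x \<partial>\<kappa>\<bar>"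
          by simp
        also have "\<dots> \<le> (\<integral>x. \<bar>f x - g x\<bar> \<partial>\<kappa>)"
          by (rule integral_abs_bound)
        also have "\<dots> \<le> (\<integral>x. e \<partial>\<kappa>)"
        proof (rule integral_mono_AE)
          show "AE x in \<kappa>. \<bar>f x - g x\<bar> \<le> e"
            using that(2) by eventually_elim (use g(2) in force)
        qed (use \<open>integrable \<kappa> f\<close> ig in auto)
        also have "\<dots> = e" using prob_space by simp
        finally show ?thesis using ig pow by (auto simp: g_eq)
      qed
      show ?thesis
        using close[OF assms(1) \<mu>01] close[OF assms(2) \<nu>01]
        by (simp only: moments, elim conjE, linarith)
    qed
    \<comment> \<open>The summand 0 gives the bound the shape that \<open>field_le_epsilon\<close>
      expects.\<close>
    have "\<bar>(\<integral>x. f x \<partial>\<mu>) - (\<integral>x. f x \<partial>\<nu>)\<bar> \<le> 0 + e" if "e > 0" for e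
      using approx[of "e / 2"] that by simp
    then have "\<bar>(\<integral>x. f x \<partial>\<mu>) - (\<integral>x. f x \<partial>\<nu>)\<bar> \<le> 0" by (rule field_le_epsilon)
    then show ?thesis by simp
  qed
  have "char \<mu> = char \<nu>"
  proof
    fix t
    \<comment> \<open>Real and imaginary parts are separated because \<open>cont_eq\<close> speaks
      of real test functions.\<close>
    have char_eq: "char \<kappa> t = Complex (\<integral>x. cos (t * x) \<partial>\<kappa>) (\<integral>x. sin (t * x) \<partial>\<kappa>)"
      if "real_distribution \<kappa>" for \<kappa>
    proof -
      interpret real_distribution \<kappa> by fact
      have int: "integrable \<kappa> (\<lambda>x. iexp (t * x))"
        by (rule integrable_iexp) auto
      show ?thesis
        by (rule complex_eqI)
          (simp_all add: char_def integral_Re[OF int, symmetric] integral_Im[OF int, symmetric]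
            Re_exp Im_exp del: of_real_mult)
    qed
    show "char \<mu> t = char \<nu> t"
      unfolding char_eq[OF assms(1)] char_eq[OF assms(2)]
      by (intro arg_cong2[where f = Complex] cont_eq continuous_intros) auto
  qed
  then show ?thesis using Levy_uniqueness assms(1,2) by blast
qed

text \<open>The values of the transform at the integers are the moments of the image under
  \<open>x \<mapsto> exp (- x)\<close>, which is supported in the unit interval.\<close>

lemma laplace_stieltjes_unique:
  fixes N N' :: "real measure"
  assumes N: "prob_space N" "sets N = sets borel" "AE x in N. 0 \<le> x"
    and N': "prob_space N'" "sets N' = sets borel" "AE x in N'. 0 \<le> x"
    and eq: "\<And>z. z \<ge> 0 \<Longrightarrow> laplace_stieltjes N z = laplace_stieltjes N' z"
  shows "N = N'"
proof -
  let ?F = "\<lambda>K. distr K borel (\<lambda>x::real. exp (- x))"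
  have facts: "real_distribution (?F K)" "AE x in ?F K. x \<in> {0..1}"
      "\<And>n. (\<integral>x. x ^ n \<partial>?F K) = laplace_stieltjes K (real n)"
      "distr (?F K) borel (\<lambda>u. - ln u) = K"
    if K: "prob_space K" "sets K = sets borel" "AE x in K. 0 \<le> x" for K
  proof -
    interpret prob_space K by fact
    have m[measurable]: "(\<lambda>x::real. exp (- x)) \<in> borel_measurable K"
      using K(2) by (simp cong: measurable_cong_sets)
    show "real_distribution (?F K)" by (rule real_distribution_distr) (rule m)
    show "AE x in ?F K. x \<in> {0..1}"
      using K(3) by (subst AE_distr_iff) auto
    show "(\<integral>x. x ^ n \<partial>?F K) = laplace_stieltjes K (real n)" for n
      by (subst integral_distr) (auto simp: laplace_stieltjes_def exp_of_nat_mult[symmetric])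
    \<comment> \<open>The substitution loses nothing: \<open>- ln\<close> inverts it on all of the
      real line, so equal images force equal laws.\<close>
    have "distr (?F K) borel (\<lambda>u. - ln u) = distr K borel (\<lambda>x. x)"
      by (subst distr_distr) (auto simp: comp_def)
    also have "\<dots> = K" using K(2) by (metis distr_id2)
    finally show "distr (?F K) borel (\<lambda>u. - ln u) = K" .
  qed
  have "?F N = ?F N'"
    by (rule unit_interval_distribution_eq_of_moments)
      (use facts[OF N] facts[OF N'] eq in auto)
  then show ?thesis using facts(4)[OF N] facts(4)[OF N'] by metis
qed

section \<open>Independence\<close>

context prob_space
begin

text \<open>A finite set of index pairs splits into groups with a common first index. The
  intersection over one group lies in the sigma-algebra of that family, so independence between
  families factors the groups, and independence inside a family factors each group.\<close>

lemma indep_vars_Sigma: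
  assumes vars: "\<And>j. j \<in> J \<Longrightarrow> indep_vars (\<lambda>_. N j) (X j) (T j)"
    and fams: "indep_sets (\<lambda>j. gen_events (N j) (X j) (T j)) J"
  shows "indep_vars (\<lambda>(j, i). N j) (\<lambda>(j, i). X j i) (Sigma J T)"
  unfolding indep_vars_def2
proof (intro conjI ballI)
  have rv: "random_variable (N j) (X j i)" if "j \<in> J" "i \<in> T j" for i j
    using vars[OF that(1)] that(2) by (simp add: indep_vars_def2)
  then show "random_variable (case ji of (j, i) \<Rightarrow> N j) (case ji of (j, i) \<Rightarrow> X j i)"
    if "ji \<in> Sigma J T" for ji
    using that by auto
  show "indep_sets (\<lambda>ji. {(case ji of (j, i) \<Rightarrow> X j i) -` A \<inter> space M |A.
      A \<in> sets (case ji of (j, i) \<Rightarrow> N j)}) (Sigma J T)"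
  proof (rule indep_setsI)
    fix ji assume "ji \<in> Sigma J T"
    then show "{(case ji of (j, i) \<Rightarrow> X j i) -` A \<inter> space M |A.
        A \<in> sets (case ji of (j, i) \<Rightarrow> N j)} \<subseteq> events"
      using rv by (auto intro!: measurable_sets)
  next
    fix A K
    assume K: "K \<noteq> {}" "K \<subseteq> Sigma J T" "finite K"
      and A: "\<forall>ji\<in>K. A ji \<in> {(case ji of (j, i) \<Rightarrow> X j i) -` A \<inter> space M |A.
        A \<in> sets (case ji of (j, i) \<Rightarrow> N j)}"
    define R where "R j = {i. (j, i) \<in> K}" for j
    have fin: "finite (R j)" for j
      using finite_vimageI[OF K(3), of "Pair j"] by (simp add: R_def vimage_def inj_on_def)
    \<comment> \<open>Written as the union of its fibres, \<open>K\<close> turns the iterated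
      product over groups and members back into a product over \<open>K\<close>.\<close>
    have K_eq: "K = Sigma (fst ` K) R"
      by (rule set_eqI) (auto simp: R_def intro: rev_image_eqI)
    have sub: "fst ` K \<subseteq> J" and RT: "R j \<subseteq> T j" for j using K(2) by (auto simp: R_def)
    have ne: "R j \<noteq> {}" if "j \<in> fst ` K" for j using that by (auto simp: R_def)
    have Aji: "A (j, i) \<in> {X j i -` B \<inter> space M |B. B \<in> sets (N j)}" if "i \<in> R j" for i j
      using bspec[OF A, of "(j, i)"] that by (simp add: R_def)
    define C where "C j = (\<Inter>i\<in>R j. A (j, i))" for j
    have C_gen: "C j \<in> gen_events (N j) (X j) (T j)" if "j \<in> fst ` K" for j
    proof -
      interpret G: sigma_algebra "space M" "gen_events (N j) (X j) (T j)"
        unfolding gen_events_def by (rule sigma_algebra_sigma_sets) auto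
      show ?thesis unfolding C_def
      proof (rule G.finite_INT[OF fin ne[OF that]])
        fix i assume i: "i \<in> R j"
        show "A (j, i) \<in> gen_events (N j) (X j) (T j)"
          unfolding gen_events_def
          by (rule sigma_sets.Basic, rule UN_I, rule subsetD[OF RT i], rule Aji[OF i])
      qed
    qed
    have "(\<Inter>ji\<in>K. A ji) = (\<Inter>j\<in>fst ` K. C j)"
      unfolding C_def R_def by (intro equalityI subsetI INT_I) (auto dest: INT_D[where a = "(_, _)"])
    also have "prob \<dots> = (\<Prod>j\<in>fst ` K. prob (C j))"
      by (rule indep_setsD[OF fams sub]) (use K(1,3) C_gen in simp_all)
    also have "\<dots> = (\<Prod>j\<in>fst ` K. \<Prod>i\<in>R j. prob (A (j, i)))"
    proof (rule prod.cong[OF refl])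
      fix j assume j: "j \<in> fst ` K"
      have "indep_sets (\<lambda>i. {X j i -` B \<inter> space M |B. B \<in> sets (N j)}) (T j)"
        using vars[OF subsetD[OF sub j]] by (simp add: indep_vars_def2)
      then show "prob (C j) = (\<Prod>i\<in>R j. prob (A (j, i)))"
        unfolding C_def by (rule indep_setsD) (intro RT ne[OF j] fin ballI Aji)+
    qed
    also have "\<dots> = (\<Prod>ji\<in>K. prob (A ji))"
      using K(3) fin by (simp add: prod.Sigma case_prod_unfold K_eq[symmetric])
    finally show "prob (\<Inter>ji\<in>K. A ji) = (\<Prod>ji\<in>K. prob (A ji))" .
  qed
qed

lemma indep_vars_discrete_map:
  assumes "indep_vars (\<lambda>_. count_space UNIV) X T"
  shows "indep_vars (\<lambda>_. count_space UNIV) (\<lambda>i \<omega>. h (X i \<omega>)) T"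
  using assms by (rule indep_vars_compose2) simp

text \<open>A preimage under \<open>h\<close> composed with a variable is a preimage under that
  variable, and in a discrete space every set is admissible. The two index sets may differ so that
  \<open>B t\<close> at the single index 0 can be compared with the whole process
  \<open>B\<close>.\<close>

lemma gen_events_discrete_map_subset:
  assumes "\<And>i. i \<in> S \<Longrightarrow> \<exists>k\<in>T. X i = X' k"
  shows "gen_events (count_space UNIV) (\<lambda>i \<omega>. h (X i \<omega>)) S \<subseteq> gen_events (count_space UNIV) X' T"
  unfolding gen_events_def
proof (rule sigma_sets_mono', safe)
  fix i A assume "i \<in> S"
  then obtain k where k: "k \<in> T" "X i = X' k" using assms by blast
  have "(\<lambda>\<omega>. h (X i \<omega>)) -` A \<inter> space M = X' k -` (h -` A) \<inter> space M"
    unfolding k(2) by (simp add: vimage_def)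
  then have "(\<lambda>\<omega>. h (X i \<omega>)) -` A \<inter> space M \<in>
      {X' k -` A \<inter> space M |A. A \<in> sets (count_space UNIV)}"
    by (intro CollectI exI[of _ "h -` A"]) simp
  with k(1) show "(\<lambda>\<omega>. h (X i \<omega>)) -` A \<inter> space M \<in>
      (\<Union>i\<in>T. {X' i -` A \<inter> space M |A. A \<in> sets (count_space UNIV)})"
    by (rule UN_I)
qed

lemma iid_vars_imp_indep_vars: "iid_vars N X T \<Longrightarrow> indep_vars (\<lambda>_. N) X T"
  unfolding iid_vars_def by blast

lemma iid_vars_imp_measurable: "iid_vars N X T \<Longrightarrow> i \<in> T \<Longrightarrow> random_variable N (X i)"
  unfolding iid_vars_def indep_vars_def2 by blast

text \<open>Both properties depend only on the law of the variable. They let index 1 stand for every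
  claim index.\<close>

lemma
  fixes f :: "'c \<Rightarrow> real"
  assumes "iid_vars N X T" "i \<in> T" "j \<in> T" "f \<in> borel_measurable N"
  shows iid_vars_integrable_iff:
      "integrable M (\<lambda>\<omega>. f (X i \<omega>)) \<longleftrightarrow> integrable M (\<lambda>\<omega>. f (X j \<omega>))"
    and iid_vars_expectation_eq: "expectation (\<lambda>\<omega>. f (X i \<omega>)) = expectation (\<lambda>\<omega>. f (X j \<omega>))"
proof -
  note X = iid_vars_imp_measurable[OF assms(1)]
  have eq: "distr M N (X i) = distr M N (X j)"
    using assms(1-3) unfolding iid_vars_def by blast
  show "integrable M (\<lambda>\<omega>. f (X i \<omega>)) \<longleftrightarrow> integrable M (\<lambda>\<omega>. f (X j \<omega>))"
    unfolding integrable_distr_eq[OF X[OF assms(2)] assms(4), symmetric]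
      integrable_distr_eq[OF X[OF assms(3)] assms(4), symmetric] eq ..
  show "expectation (\<lambda>\<omega>. f (X i \<omega>)) = expectation (\<lambda>\<omega>. f (X j \<omega>))"
    unfolding integral_distr[OF X[OF assms(2)] assms(4), symmetric]
      integral_distr[OF X[OF assms(3)] assms(4), symmetric] eq ..
qed

lemma indep_var_of_indep_vars:
  assumes "indep_vars N X T" "i \<in> T" "j \<in> T" "i \<noteq> j"
  shows "indep_var (N i) (X i) (N j) (X j)"
proof -
  \<comment> \<open>The pair is obtained from independence of the disjoint blocks \<open>{i}\<close>
    and \<open>{j}\<close>, followed by evaluation at the only coordinate of each.\<close>
  have "indep_var (N i) ((\<lambda>f. f i) \<circ> (\<lambda>\<omega>. restrict (\<lambda>i. X i \<omega>) {i}))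
      (N j) ((\<lambda>f. f j) \<circ> (\<lambda>\<omega>. restrict (\<lambda>i. X i \<omega>) {j}))"
    by (rule indep_var_compose[OF indep_var_restrict[OF assms(1)]]) (use assms in auto)
  then show ?thesis by (simp add: comp_def)
qed

text \<open>This is conditioning on a discrete event without conditional expectations. It serves
  twice: to fix the number of claims and to fix the type of one claim.\<close>

lemma
  fixes f :: "'c \<Rightarrow> real"
  assumes ind: "indep_var N1 X N2 Y" and A: "A \<in> sets N1"
    and f: "f \<in> borel_measurable N2" "integrable M (\<lambda>\<omega>. f (Y \<omega>))"
  shows integrable_indicator_mult_indep: "integrable M (\<lambda>\<omega>. indicator A (X \<omega>) * f (Y \<omega>))"
    and expectation_indicator_mult_indep:
      "expectation (\<lambda>\<omega>. indicator A (X \<omega>) * f (Y \<omega>)) =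
        prob {\<omega> \<in> space M. X \<omega> \<in> A} * expectation (\<lambda>\<omega>. f (Y \<omega>))"
proof -
  have ind': "indep_var borel (\<lambda>\<omega>. indicator A (X \<omega>)) borel (\<lambda>\<omega>. f (Y \<omega>))"
    using indep_var_compose[OF ind, of "indicator A :: _ \<Rightarrow> real" borel f borel] A f(1)
    by (simp add: comp_def)
  have [measurable]: "X \<in> measurable M N1" using ind by (rule indep_var_rv1)
  note A[measurable]
  have int: "integrable M (\<lambda>\<omega>. indicator A (X \<omega>) :: real)"
    by (rule integrable_const_bound[where B = 1]) (auto simp: indicator_def)
  show "integrable M (\<lambda>\<omega>. indicator A (X \<omega>) * f (Y \<omega>))"
    using indep_var_integrable[OF ind' int f(2)] .
  have "expectation (\<lambda>\<omega>. indicator A (X \<omega>)) = expectation (indicator {\<omega> \<in> space M. X \<omega> \<in> A})"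
    by (rule Bochner_Integration.integral_cong) (auto simp: indicator_def)
  also have "\<dots> = prob {\<omega> \<in> space M. X \<omega> \<in> A}" by simp
  finally show "expectation (\<lambda>\<omega>. indicator A (X \<omega>) * f (Y \<omega>)) =
        prob {\<omega> \<in> space M. X \<omega> \<in> A} * expectation (\<lambda>\<omega>. f (Y \<omega>))"
    using indep_var_lebesgue_integral[OF ind' int f(2)] by simp
qed

end


section \<open>Random sums\<close>

context prob_space
begin

text \<open>Almost surely exactly one of the events \<open>K = n\<close> with
  \<open>n \<le> t\<close> occurs, so the random sum is a finite sum of indicator terms, each of
  which factors. Putting the count in slot 0 expresses its independence from all terms by a single
  \<open>indep_vars\<close> statement.\<close>

lemma random_sum_expectation:
  fixes Z :: "nat \<Rightarrow> 'a \<Rightarrow> real" and g :: "real \<Rightarrow> real"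
  assumes ind: "indep_vars (\<lambda>_. borel) (\<lambda>i. if i = 0 then (\<lambda>\<omega>. real (K \<omega>)) else Z i) UNIV"
    and K: "random_variable (count_space UNIV) K" "AE \<omega> in M. K \<omega> \<le> t"
    and g: "g \<in> borel_measurable borel"
      "\<And>n. n \<le> t \<Longrightarrow> integrable M (\<lambda>\<omega>. g (\<Sum>i = 1..n. Z i \<omega>))"
  shows "integrable M (\<lambda>\<omega>. g (\<Sum>i = 1..K \<omega>. Z i \<omega>)) \<and>
    expectation (\<lambda>\<omega>. g (\<Sum>i = 1..K \<omega>. Z i \<omega>)) =
      (\<Sum>n\<le>t. prob {\<omega> \<in> space M. K \<omega> = n} * expectation (\<lambda>\<omega>. g (\<Sum>i = 1..n. Z i \<omega>)))"
proof -
  note K(1)[measurable] g(1)[measurable]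
  have [measurable]: "random_variable borel (Z i)" if "i \<ge> 1" for i
    using ind that unfolding indep_vars_def by (metis UNIV_I not_one_le_zero)
  have terms: "integrable M (\<lambda>\<omega>. indicator {real n} (real (K \<omega>)) * g (\<Sum>i = 1..n. Z i \<omega>))"
    "expectation (\<lambda>\<omega>. indicator {real n} (real (K \<omega>)) * g (\<Sum>i = 1..n. Z i \<omega>)) =
      prob {\<omega> \<in> space M. K \<omega> = n} * expectation (\<lambda>\<omega>. g (\<Sum>i = 1..n. Z i \<omega>))"
    if "n \<le> t" for n
  proof -
    have "indep_var borel ((\<lambda>i. if i = 0 then (\<lambda>\<omega>. real (K \<omega>)) else Z i) 0) borel
        (\<lambda>\<omega>. \<Sum>i = 1..n. (if i = 0 then (\<lambda>\<omega>. real (K \<omega>)) else Z i) \<omega>)"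
      by (rule indep_vars_sum[OF _ _ indep_vars_subset[OF ind]]) auto
    also have "(\<lambda>\<omega>. \<Sum>i = 1..n. (if i = 0 then (\<lambda>\<omega>. real (K \<omega>)) else Z i) \<omega>) =
        (\<lambda>\<omega>. \<Sum>i = 1..n. Z i \<omega>)"
      by (intro ext sum.cong) auto
    finally have "indep_var borel (\<lambda>\<omega>. real (K \<omega>)) borel (\<lambda>\<omega>. \<Sum>i = 1..n. Z i \<omega>)" by simp
    from integrable_indicator_mult_indep[OF this _ g(1) g(2)[OF that], of "{real n}"]
      expectation_indicator_mult_indep[OF this _ g(1) g(2)[OF that], of "{real n}"]
    show "integrable M (\<lambda>\<omega>. indicator {real n} (real (K \<omega>)) * g (\<Sum>i = 1..n. Z i \<omega>))"
      "expectation (\<lambda>\<omega>. indicator {real n} (real (K \<omega>)) * g (\<Sum>i = 1..n. Z i \<omega>)) =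
        prob {\<omega> \<in> space M. K \<omega> = n} * expectation (\<lambda>\<omega>. g (\<Sum>i = 1..n. Z i \<omega>))"
      by auto
  qed
  have AE_eq: "AE \<omega> in M. (\<Sum>n\<le>t. indicator {real n} (real (K \<omega>)) * g (\<Sum>i = 1..n. Z i \<omega>)) =
      g (\<Sum>i = 1..K \<omega>. Z i \<omega>)"
    using K(2)
  proof eventually_elim
    case (elim \<omega>)
    have "(\<Sum>n\<le>t. indicator {real n} (real (K \<omega>)) * g (\<Sum>i = 1..n. Z i \<omega>)) =
        (\<Sum>n\<le>t. if n = K \<omega> then g (\<Sum>i = 1..n. Z i \<omega>) else 0)"
      by (intro sum.cong) (auto simp: indicator_def)
    with elim show ?case by simp
  qed
  have [measurable]: "(\<lambda>\<omega>. \<Sum>i = 1..n. Z i \<omega>) \<in> borel_measurable M" for n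
    by (rule borel_measurable_sum) simp
  \<comment> \<open>Replacing an integrand by an almost surely equal one requires both to be
    measurable; here this follows by splitting over the countably many values of
    \<open>K\<close>.\<close>
  have meas: "(\<lambda>\<omega>. g (\<Sum>i = 1..K \<omega>. Z i \<omega>)) \<in> borel_measurable M"
    by (rule measurable_compose_countable[OF _ K(1), of "\<lambda>n \<omega>. g (\<Sum>i = 1..n. Z i \<omega>)"]) simp
  have int: "integrable M (\<lambda>\<omega>. \<Sum>n\<le>t. indicator {real n} (real (K \<omega>)) * g (\<Sum>i = 1..n. Z i \<omega>))"
    by (intro Bochner_Integration.integrable_sum terms(1)) simp
  have int_g: "integrable M (\<lambda>\<omega>. g (\<Sum>i = 1..K \<omega>. Z i \<omega>))"
    using integrable_cong_AE[OF borel_measurable_integrable[OF int] meas AE_eq] int by (rule iffD1)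
  have "expectation (\<lambda>\<omega>. g (\<Sum>i = 1..K \<omega>. Z i \<omega>)) =
      expectation (\<lambda>\<omega>. \<Sum>n\<le>t. indicator {real n} (real (K \<omega>)) * g (\<Sum>i = 1..n. Z i \<omega>))"
    using integral_cong_AE[OF borel_measurable_integrable[OF int] meas AE_eq] by simp
  also have "\<dots> =
      (\<Sum>n\<le>t. expectation (\<lambda>\<omega>. indicator {real n} (real (K \<omega>)) * g (\<Sum>i = 1..n. Z i \<omega>)))"
    by (intro Bochner_Integration.integral_sum terms(1)) simp
  also have "\<dots> = (\<Sum>n\<le>t. prob {\<omega> \<in> space M. K \<omega> = n} * expectation (\<lambda>\<omega>. g (\<Sum>i = 1..n. Z i \<omega>)))"
    by (intro sum.cong terms(2)) auto
  finally show ?thesis using int_g by blast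
qed

section \<open>Exponential and first two moments of sums with a fixed number of terms\<close>

lemma iid_sum_exp_expectation:
  fixes Z :: "nat \<Rightarrow> 'a \<Rightarrow> real"
  assumes ind: "indep_vars (\<lambda>_. borel) Z {1..}"
    and int: "\<And>i. i \<ge> 1 \<Longrightarrow> integrable M (\<lambda>\<omega>. exp (c * Z i \<omega>))"
    and m: "\<And>i. i \<ge> 1 \<Longrightarrow> expectation (\<lambda>\<omega>. exp (c * Z i \<omega>)) = m"
  shows "integrable M (\<lambda>\<omega>. exp (c * (\<Sum>i = 1..n. Z i \<omega>)))"
    and "expectation (\<lambda>\<omega>. exp (c * (\<Sum>i = 1..n. Z i \<omega>))) = m ^ n"
proof -
  have eq: "exp (c * (\<Sum>i = 1..n. Z i \<omega>)) = (\<Prod>i\<in>{1..n}. exp (c * Z i \<omega>))" for \<omega>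
    by (simp add: sum_distrib_left exp_sum)
  have "indep_vars (\<lambda>_. borel) (\<lambda>i \<omega>. exp (c * Z i \<omega>)) {1..n}"
    by (rule indep_vars_compose2[OF indep_vars_subset[OF ind]]) auto
  note prod_facts = indep_vars_integrable[OF _ this] indep_vars_lebesgue_integral[OF _ this]
  show "integrable M (\<lambda>\<omega>. exp (c * (\<Sum>i = 1..n. Z i \<omega>)))"
    unfolding eq by (rule prod_facts(1)) (use int in auto)
  have "expectation (\<lambda>\<omega>. \<Prod>i\<in>{1..n}. exp (c * Z i \<omega>)) =
      (\<Prod>i\<in>{1..n}. expectation (\<lambda>\<omega>. exp (c * Z i \<omega>)))"
    by (rule prod_facts(2)) (use int in auto)
  also have "\<dots> = m ^ n" using m by simp
  finally show "expectation (\<lambda>\<omega>. exp (c * (\<Sum>i = 1..n. Z i \<omega>))) = m ^ n"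
    unfolding eq .
qed

lemma iid_sum_expectation:
  fixes Z :: "nat \<Rightarrow> 'a \<Rightarrow> real"
  assumes int: "\<And>i. i \<ge> 1 \<Longrightarrow> integrable M (Z i)"
    and m: "\<And>i. i \<ge> 1 \<Longrightarrow> expectation (Z i) = m"
  shows "integrable M (\<lambda>\<omega>. \<Sum>i = 1..n. Z i \<omega>)"
    and "expectation (\<lambda>\<omega>. \<Sum>i = 1..n. Z i \<omega>) = real n * m"
  using int m by (auto simp: Bochner_Integration.integral_sum)

text \<open>The square has \<open>n\<close> diagonal terms and \<open>n * (n - 1)\<close> ordered
  pairs of distinct indices, the latter contributing \<open>m * m\<close> each by independence. This
  grouping matches the factorial moments of the binomial law. In the induction the cross term adds
  \<open>2 * n\<close> such pairs.\<close>

lemma iid_sum_square_expectation: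
  fixes Z :: "nat \<Rightarrow> 'a \<Rightarrow> real"
  assumes ind: "indep_vars (\<lambda>_. borel) Z {1..}"
    and int: "\<And>i. i \<ge> 1 \<Longrightarrow> integrable M (Z i)"
    and m: "\<And>i. i \<ge> 1 \<Longrightarrow> expectation (Z i) = m"
    and int2: "\<And>i. i \<ge> 1 \<Longrightarrow> integrable M (\<lambda>\<omega>. (Z i \<omega>)\<^sup>2)"
    and q: "\<And>i. i \<ge> 1 \<Longrightarrow> expectation (\<lambda>\<omega>. (Z i \<omega>)\<^sup>2) = q"
  shows "integrable M (\<lambda>\<omega>. (\<Sum>i = 1..n. Z i \<omega>)\<^sup>2) \<and>
    expectation (\<lambda>\<omega>. (\<Sum>i = 1..n. Z i \<omega>)\<^sup>2) = real n * q + real n * (real n - 1) * m\<^sup>2"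
proof (induction n)
  case 0
  then show ?case by simp
next
  case (Suc n)
  let ?T = "\<lambda>\<omega>. \<Sum>i = 1..n. Z i \<omega>"
  have indT: "indep_var borel (Z (Suc n)) borel ?T"
    by (rule indep_vars_sum[OF _ _ indep_vars_subset[OF ind]]) auto
  note T = iid_sum_expectation[of Z, OF int m, of n]
  have prod: "integrable M (\<lambda>\<omega>. Z (Suc n) \<omega> * ?T \<omega>)"
    "expectation (\<lambda>\<omega>. Z (Suc n) \<omega> * ?T \<omega>) = m * (real n * m)"
    using indep_var_integrable[OF indT _ T(1)] indep_var_lebesgue_integral[OF indT _ T(1)] T(2) int m
    by auto
  have eq: "(\<Sum>i = 1..Suc n. Z i \<omega>)\<^sup>2 = (Z (Suc n) \<omega>)\<^sup>2 + 2 * (Z (Suc n) \<omega> * ?T \<omega>) + (?T \<omega>)\<^sup>2" for \<omega>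
    by (simp add: power2_eq_square algebra_simps)
  have int3: "integrable M (\<lambda>\<omega>. (Z (Suc n) \<omega>)\<^sup>2 + 2 * (Z (Suc n) \<omega> * ?T \<omega>))"
    using prod(1) int2[of "Suc n"] by simp
  have "expectation (\<lambda>\<omega>. (Z (Suc n) \<omega>)\<^sup>2 + 2 * (Z (Suc n) \<omega> * ?T \<omega>) + (?T \<omega>)\<^sup>2) =
      expectation (\<lambda>\<omega>. (Z (Suc n) \<omega>)\<^sup>2 + 2 * (Z (Suc n) \<omega> * ?T \<omega>)) + expectation (\<lambda>\<omega>. (?T \<omega>)\<^sup>2)"
    using int3 Suc.IH by (intro Bochner_Integration.integral_add) auto
  also have "expectation (\<lambda>\<omega>. (Z (Suc n) \<omega>)\<^sup>2 + 2 * (Z (Suc n) \<omega> * ?T \<omega>)) =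
      q + 2 * (m * (real n * m))"
    using prod int2[of "Suc n"] q[of "Suc n"] by simp
  also have "q + 2 * (m * (real n * m)) + expectation (\<lambda>\<omega>. (?T \<omega>)\<^sup>2) =
      real (Suc n) * q + real (Suc n) * (real (Suc n) - 1) * m\<^sup>2"
    using Suc.IH by (simp add: power2_eq_square algebra_simps)
  finally show ?case
    unfolding eq using Bochner_Integration.integrable_add[OF int3] Suc.IH by blast
qed

end

section \<open>The compound binomial model\<close>

context compound_binomial_model
begin

definition claim :: "nat \<Rightarrow> 'a \<Rightarrow> real" where
  "claim i \<omega> = real_of_int (I 1 i \<omega> * Y 1 i \<omega> + I 0 i \<omega> * (Y 3 i \<omega> + Y 4 i \<omega>) + I 2 i \<omega> * Y 2 i \<omega>)"

lemma compound_sum_eq: "real_of_int (compound_sum B I Y t \<omega>) = (\<Sum>i = 1..B t \<omega>. claim i \<omega>)"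
proof -
  have "compound_sum B I Y t \<omega> = (\<Sum>i = 1..B t \<omega>.
      I 1 i \<omega> * Y 1 i \<omega> + I 0 i \<omega> * (Y 3 i \<omega> + Y 4 i \<omega>) + I 2 i \<omega> * Y 2 i \<omega>)"
    unfolding compound_sum_def by (rule sum.mono_neutral_cong_right) auto
  then show ?thesis by (simp add: claim_def)
qed

lemma B_measurable: "random_variable (count_space UNIV) (B t)"
  using B by (auto simp: binomial_process_def)

text \<open>In Bernstein form the weights come with known sums against \<open>n\<close> and
  \<open>n * (n - 1)\<close>, that is, with the first two factorial moments.\<close>

lemma prob_B: "prob {\<omega> \<in> space M. B t \<omega> = n} = Bernstein t n (p0 + p1 + p2)"
proof -
  have "prob {\<omega> \<in> space M. B t \<omega> = n} = measure (distr M (count_space UNIV) (B t)) {n}"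
    by (subst measure_distr[OF B_measurable]) (auto intro!: arg_cong[where f = prob])
  also have "\<dots> = pmf (binomial_pmf t (p0 + p1 + p2)) n"
    using B by (simp add: binomial_process_def measure_pmf_single)
  finally show ?thesis using p_range by (simp add: Bernstein_def)
qed

lemma B_le: "AE \<omega> in M. B t \<omega> \<le> t"
proof -
  have distr_B: "distr M (count_space UNIV) (B t) = measure_pmf (binomial_pmf t (p0 + p1 + p2))"
    using B by (simp add: binomial_process_def)
  have "AE n in distr M (count_space UNIV) (B t). n \<le> t"
    unfolding distr_B
    using p_range by (auto simp: AE_measure_pmf_iff set_pmf_binomial_eq split: if_splits)
  then show ?thesis by (subst (asm) AE_distr_iff[OF B_measurable]) auto
qed

text \<open>The five families are padded to a common value type, because the value spaces of
  \<^const>\<open>indep_vars\<close> must share one type.\<close>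

definition source :: "nat \<Rightarrow> nat \<Rightarrow> nat \<Rightarrow> 'a \<Rightarrow> int \<times> int \<times> int" where
  "source t j i \<omega> = [(int (B t \<omega>), 0, 0), (I 1 i \<omega>, I 2 i \<omega>, I 0 i \<omega>), (Y 1 i \<omega>, 0, 0),
     (Y 2 i \<omega>, 0, 0), (Y 3 i \<omega>, Y 4 i \<omega>, 0)] ! j"

text \<open>For fixed \<open>t\<close> the count is one variable and not a sequence, so family 0 has
  a single index.\<close>

definition source_index :: "nat \<Rightarrow> nat set" where
  "source_index j = (if j = 0 then {0} else {1..})"

lemma indep_vars_source:
  "indep_vars (\<lambda>_. count_space UNIV) (\<lambda>(j, i). source t j i) (Sigma {..<5} source_index)"
proof -
  let ?pad1 = "\<lambda>x::int. (x, 0::int, 0::int)" and ?pad2 = "\<lambda>(x::int, y::int). (x, y, 0::int)"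
  have source_eq:
    "source t 0 = (\<lambda>i \<omega>. (int (B t \<omega>), 0, 0))"
    "source t 1 = (\<lambda>i \<omega>. (I 1 i \<omega>, I 2 i \<omega>, I 0 i \<omega>))"
    "source t 2 = (\<lambda>i \<omega>. ?pad1 (Y 1 i \<omega>))"
    "source t 3 = (\<lambda>i \<omega>. ?pad1 (Y 2 i \<omega>))"
    "source t 4 = (\<lambda>i \<omega>. ?pad2 (Y 3 i \<omega>, Y 4 i \<omega>))"
    by (simp_all add: source_def[abs_def])
  have index_eq: "source_index 0 = {0}" "source_index 1 = {1..}" "source_index 2 = {1..}"
    "source_index 3 = {1..}" "source_index 4 = {1..}"
    by (simp_all add: source_index_def)
  have cases: "P j" if "P 0" "P 1" "P 2" "P 3" "P 4" "j < 5" for P and j :: nat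
  proof -
    from \<open>j < 5\<close> have "j = 0 \<or> j = 1 \<or> j = 2 \<or> j = 3 \<or> j = 4" by linarith
    with that show ?thesis by blast
  qed
  have B0: "indep_vars (\<lambda>_. count_space UNIV) (\<lambda>i. B t) {0::nat}"
    unfolding indep_vars_def2
  proof (intro conjI ballI indep_setsI)
    fix A J
    assume "J \<noteq> {}" "J \<subseteq> {0::nat}"
    then have "J = {0}" by auto
    then show "prob (\<Inter>j\<in>J. A j) = (\<Prod>j\<in>J. prob (A j))" by simp
  qed (auto intro!: measurable_sets B_measurable)
  have vars: "indep_vars (\<lambda>_. count_space UNIV) (source t j) (source_index j)" if "j < 5" for j
    using that
  proof (rule cases[rotated -1])
    show "indep_vars (\<lambda>_. count_space UNIV) (source t 0) (source_index 0)"
      unfolding source_eq index_eq using B0 by (rule indep_vars_discrete_map)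
    show "indep_vars (\<lambda>_. count_space UNIV) (source t 1) (source_index 1)"
      unfolding source_eq index_eq using I_iid by (rule iid_vars_imp_indep_vars)
    show "indep_vars (\<lambda>_. count_space UNIV) (source t 2) (source_index 2)"
      unfolding source_eq index_eq
      by (rule indep_vars_discrete_map) (rule iid_vars_imp_indep_vars[OF Y1_iid])
    show "indep_vars (\<lambda>_. count_space UNIV) (source t 3) (source_index 3)"
      unfolding source_eq index_eq
      by (rule indep_vars_discrete_map) (rule iid_vars_imp_indep_vars[OF Y2_iid])
    show "indep_vars (\<lambda>_. count_space UNIV) (source t 4) (source_index 4)"
      unfolding source_eq index_eq
      by (rule indep_vars_discrete_map) (rule iid_vars_imp_indep_vars[OF Y34_iid])
  qed
  let ?F = "\<lambda>j. [gen_events (count_space UNIV) B UNIV,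
      gen_events (count_space UNIV) (\<lambda>i \<omega>. (I 1 i \<omega>, I 2 i \<omega>, I 0 i \<omega>)) {1..},
      gen_events (count_space UNIV) (Y 1) {1..},
      gen_events (count_space UNIV) (Y 2) {1..},
      gen_events (count_space UNIV) (\<lambda>i \<omega>. (Y 3 i \<omega>, Y 4 i \<omega>)) {1..}] ! j"
  have F_eq: "?F 0 = gen_events (count_space UNIV) B UNIV"
    "?F 1 = gen_events (count_space UNIV) (\<lambda>i \<omega>. (I 1 i \<omega>, I 2 i \<omega>, I 0 i \<omega>)) {1..}"
    "?F 2 = gen_events (count_space UNIV) (Y 1) {1..}"
    "?F 3 = gen_events (count_space UNIV) (Y 2) {1..}"
    "?F 4 = gen_events (count_space UNIV) (\<lambda>i \<omega>. (Y 3 i \<omega>, Y 4 i \<omega>)) {1..}"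
    by simp_all
  \<comment> \<open>Padding acts on each variable separately and fixing \<open>t\<close> keeps one
    member of \<open>B\<close>, so no family generates more than the original one; independence is
    inherited by subsets.\<close>
  have gen: "gen_events (count_space UNIV) (source t j) (source_index j) \<subseteq> ?F j" if "j < 5" for j
    using that
  proof (rule cases[rotated -1])
    show "gen_events (count_space UNIV) (source t 0) (source_index 0) \<subseteq> ?F 0"
      unfolding source_eq index_eq F_eq
      by (rule gen_events_discrete_map_subset[where X = "\<lambda>_. B t"]) auto
    show "gen_events (count_space UNIV) (source t 1) (source_index 1) \<subseteq> ?F 1"
      unfolding source_eq index_eq F_eq ..
    show "gen_events (count_space UNIV) (source t 2) (source_index 2) \<subseteq> ?F 2"
      unfolding source_eq index_eq F_eq by (rule gen_events_discrete_map_subset) auto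
    show "gen_events (count_space UNIV) (source t 3) (source_index 3) \<subseteq> ?F 3"
      unfolding source_eq index_eq F_eq by (rule gen_events_discrete_map_subset) auto
    show "gen_events (count_space UNIV) (source t 4) (source_index 4) \<subseteq> ?F 4"
      unfolding source_eq index_eq F_eq by (rule gen_events_discrete_map_subset) auto
  qed
  have "indep_sets (\<lambda>j. gen_events (count_space UNIV) (source t j) (source_index j)) {..<5}"
    using families_indep by (rule indep_sets_mono_sets) (use gen in simp)
  with vars show ?thesis
    using indep_vars_Sigma[of "{..<5}" "\<lambda>_. count_space UNIV" "source t" source_index]
    by (simp add: case_prod_unfold)
qed

text \<open>The count reads the block \<open>{(0, 0)}\<close> and claim \<open>i\<close> reads the
  four sources with second index \<open>i\<close>. These blocks are disjoint, hence measurable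
  functions of them are independent.\<close>

lemma indep_vars_claims:
  "indep_vars (\<lambda>_. borel) (\<lambda>i. if i = 0 then (\<lambda>\<omega>. real (B t \<omega>)) else claim i) UNIV"
proof -
  define K :: "nat \<Rightarrow> (nat \<times> nat) set" where
    "K i = (if i = 0 then {(0, 0)} else {1, 2, 3, 4} \<times> {i})" for i
  \<comment> \<open>Source 1 stores the indicators in the order \<open>I 1\<close>,
    \<open>I 2\<close>, \<open>I 0\<close>, so \<open>I 0\<close> is the last component; sources 2,
    3 and 4 hold \<open>Y 1\<close>, \<open>Y 2\<close> and the pair of \<open>Y 3\<close> and
    \<open>Y 4\<close>.\<close>
  define F :: "nat \<Rightarrow> (nat \<times> nat \<Rightarrow> int \<times> int \<times> int) \<Rightarrow> real" where
    "F i f = (if i = 0 then real_of_int (fst (f (0, 0)))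
      else real_of_int (fst (f (1, i))) * real_of_int (fst (f (2, i))) +
        real_of_int (snd (snd (f (1, i)))) * real_of_int (fst (f (4, i)) + fst (snd (f (4, i)))) +
        real_of_int (fst (snd (f (1, i)))) * real_of_int (fst (f (3, i))))" for i f
  have "indep_vars (\<lambda>i. PiM (K i) (\<lambda>_. count_space UNIV))
      (\<lambda>i \<omega>. restrict (\<lambda>ji. (case ji of (j, i) \<Rightarrow> source t j i) \<omega>) (K i)) UNIV"
    by (rule indep_vars_restrict[OF indep_vars_source])
      (auto simp: K_def source_index_def disjoint_family_on_def split: if_splits)
  then have "indep_vars (\<lambda>_. borel)
      (\<lambda>i \<omega>. F i (restrict (\<lambda>ji. (case ji of (j, i) \<Rightarrow> source t j i) \<omega>) (K i))) UNIV"
  proof (rule indep_vars_compose2)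
    fix i :: nat
    \<comment> \<open>Coordinates are discrete, so every real function of one coordinate is
      measurable, and \<open>F i\<close> is built from such functions by sums and products.\<close>
    have comp: "(\<lambda>f. h (f ji)) \<in> borel_measurable (PiM (K i) (\<lambda>_. count_space UNIV))"
      if "ji \<in> K i" for ji and h :: "int \<times> int \<times> int \<Rightarrow> real"
      by (rule measurable_compose[OF measurable_component_singleton[OF that]]) simp
    show "F i \<in> borel_measurable (PiM (K i) (\<lambda>_. count_space UNIV))"
      by (cases "i = 0")
        (auto simp: F_def[abs_def] K_def intro!: borel_measurable_add borel_measurable_times comp)
  qed
  also have "(\<lambda>i \<omega>. F i (restrict (\<lambda>ji. (case ji of (j, i) \<Rightarrow> source t j i) \<omega>) (K i))) =
      (\<lambda>i. if i = 0 then (\<lambda>\<omega>. real (B t \<omega>)) else claim i)"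
    by (intro ext) (auto simp: F_def K_def source_def claim_def)
  finally show ?thesis .
qed

section \<open>The law of a single claim\<close>

lemma I_measurable:
  assumes "i \<ge> 1"
  shows "random_variable (count_space UNIV) (\<lambda>\<omega>. (I 1 i \<omega>, I 2 i \<omega>, I 0 i \<omega>))"
  using iid_vars_imp_measurable[OF I_iid] assms by simp

text \<open>The three values are disjoint events whose probabilities add up to
  \<open>p / p = 1\<close>.\<close>

lemma I_values:
  assumes i: "i \<ge> 1"
  shows "AE \<omega> in M. (I 1 i \<omega>, I 2 i \<omega>, I 0 i \<omega>) \<in> {(1, 0, 0), (0, 1, 0), (0, 0, 1)}"
proof -
  let ?E = "\<lambda>v. {\<omega> \<in> space M. (I 1 i \<omega>, I 2 i \<omega>, I 0 i \<omega>) = v}"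
  have ev: "?E v \<in> events" for v
    using measurable_sets[OF I_measurable[OF i], of "{v}"]
    by (simp add: vimage_def Int_def conj_commute)
  have "prob (?E (1, 0, 0) \<union> (?E (0, 1, 0) \<union> ?E (0, 0, 1))) =
      prob (?E (1, 0, 0)) + (prob (?E (0, 1, 0)) + prob (?E (0, 0, 1)))"
    using ev by (subst finite_measure_Union; (subst finite_measure_Union)?) auto
  also have "\<dots> = p1 / (p0 + p1 + p2) + (p2 / (p0 + p1 + p2) + p0 / (p0 + p1 + p2))"
    using I_prob[OF i] by simp
  also have "\<dots> = 1"
    using p_range by (simp add: add_divide_distrib[symmetric] add_ac)
  finally show ?thesis by (rule eventually_mono[OF AE_prob_1]) auto
qed

lemma Y_positive:
  assumes "k \<in> {1, 2, 3, 4}" "i \<ge> 1"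
  shows "AE \<omega> in M. Y k i \<omega> > 0"
  using AE_prob_1[OF Y_pos[OF assms]] by eventually_elim simp

lemma claim_positive:
  assumes i: "i \<ge> 1"
  shows "AE \<omega> in M. claim i \<omega> > 0"
proof -
  have "AE \<omega> in M. Y 1 i \<omega> > 0" "AE \<omega> in M. Y 2 i \<omega> > 0"
    "AE \<omega> in M. Y 3 i \<omega> > 0" "AE \<omega> in M. Y 4 i \<omega> > 0"
    by (rule Y_positive[OF _ i]; simp)+
  with I_values[OF i] show ?thesis by eventually_elim (auto simp: claim_def)
qed

text \<open>Almost surely one indicator is 1 and the other two are 0, so \<open>g\<close> of the
  claim is the indicator-weighted sum of \<open>g\<close> of the three candidate sizes. This works
  also when \<open>g 0\<close> is not 0, as for the exponential. Independence of type and size then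
  gives the mixture weights.\<close>

lemma claim_expectation:
  fixes g :: "real \<Rightarrow> real"
  assumes i: "i \<ge> 1" and g: "g \<in> borel_measurable borel"
    and int: "integrable M (\<lambda>\<omega>. g (real_of_int (Y 1 1 \<omega>)))"
      "integrable M (\<lambda>\<omega>. g (real_of_int (Y 3 1 \<omega> + Y 4 1 \<omega>)))"
      "integrable M (\<lambda>\<omega>. g (real_of_int (Y 2 1 \<omega>)))"
  shows "integrable M (\<lambda>\<omega>. g (claim i \<omega>)) \<and>
    expectation (\<lambda>\<omega>. g (claim i \<omega>)) =
      (p1 * expectation (\<lambda>\<omega>. g (real_of_int (Y 1 1 \<omega>))) +
       p0 * expectation (\<lambda>\<omega>. g (real_of_int (Y 3 1 \<omega> + Y 4 1 \<omega>))) +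
       p2 * expectation (\<lambda>\<omega>. g (real_of_int (Y 2 1 \<omega>)))) / (p0 + p1 + p2)"
proof -
  let ?X = "\<lambda>\<omega>. (I 1 i \<omega>, I 2 i \<omega>, I 0 i \<omega>)"
  let ?ind = "\<lambda>v \<omega>. indicator {v} (?X \<omega>) :: real"
  \<comment> \<open>The time 0 is an arbitrary choice: it enters only source 0, and here sources 1
    to 4 are compared.\<close>
  have ind: "indep_var (count_space UNIV) ?X (count_space UNIV) (source 0 j i)"
    if "j \<in> {2, 3, 4}" for j
  proof -
    have "indep_var (count_space UNIV) ((\<lambda>(j, i). source 0 j i) (1, i))
        (count_space UNIV) ((\<lambda>(j, i). source 0 j i) (j, i))"
      by (rule indep_var_of_indep_vars[OF indep_vars_source])
        (use that i in \<open>auto simp: source_index_def\<close>)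
    then show ?thesis by (simp add: source_def[abs_def])
  qed
  note split = integrable_indicator_mult_indep expectation_indicator_mult_indep
  have int_i: "integrable M (\<lambda>\<omega>. g (real_of_int (Y 1 i \<omega>)))"
      "integrable M (\<lambda>\<omega>. g (real_of_int (Y 3 i \<omega> + Y 4 i \<omega>)))"
      "integrable M (\<lambda>\<omega>. g (real_of_int (Y 2 i \<omega>)))"
    and E_i: "expectation (\<lambda>\<omega>. g (real_of_int (Y 1 i \<omega>))) = expectation (\<lambda>\<omega>. g (real_of_int (Y 1 1 \<omega>)))"
      "expectation (\<lambda>\<omega>. g (real_of_int (Y 3 i \<omega> + Y 4 i \<omega>))) =
        expectation (\<lambda>\<omega>. g (real_of_int (Y 3 1 \<omega> + Y 4 1 \<omega>)))"
      "expectation (\<lambda>\<omega>. g (real_of_int (Y 2 i \<omega>))) = expectation (\<lambda>\<omega>. g (real_of_int (Y 2 1 \<omega>)))"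
    using i int
      iid_vars_integrable_iff[OF Y1_iid, of i 1 "\<lambda>x. g (real_of_int x)"]
      iid_vars_integrable_iff[OF Y2_iid, of i 1 "\<lambda>x. g (real_of_int x)"]
      iid_vars_integrable_iff[OF Y34_iid, of i 1 "\<lambda>(x, y). g (real_of_int (x + y))"]
      iid_vars_expectation_eq[OF Y1_iid, of i 1 "\<lambda>x. g (real_of_int x)"]
      iid_vars_expectation_eq[OF Y2_iid, of i 1 "\<lambda>x. g (real_of_int x)"]
      iid_vars_expectation_eq[OF Y34_iid, of i 1 "\<lambda>(x, y). g (real_of_int (x + y))"]
    by simp_all
  have t1: "integrable M (\<lambda>\<omega>. ?ind (1, 0, 0) \<omega> * g (real_of_int (Y 1 i \<omega>)))"
    "expectation (\<lambda>\<omega>. ?ind (1, 0, 0) \<omega> * g (real_of_int (Y 1 i \<omega>))) =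
      p1 / (p0 + p1 + p2) * expectation (\<lambda>\<omega>. g (real_of_int (Y 1 1 \<omega>)))"
    using split[OF ind[of 2], of "{(1, 0, 0)}" "\<lambda>(x, _). g (real_of_int x)"] int_i E_i I_prob[OF i]
    by (simp_all add: source_def)
  have t2: "integrable M (\<lambda>\<omega>. ?ind (0, 1, 0) \<omega> * g (real_of_int (Y 2 i \<omega>)))"
    "expectation (\<lambda>\<omega>. ?ind (0, 1, 0) \<omega> * g (real_of_int (Y 2 i \<omega>))) =
      p2 / (p0 + p1 + p2) * expectation (\<lambda>\<omega>. g (real_of_int (Y 2 1 \<omega>)))"
    using split[OF ind[of 3], of "{(0, 1, 0)}" "\<lambda>(x, _). g (real_of_int x)"] int_i E_i I_prob[OF i]
    by (simp_all add: source_def)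
  have t0: "integrable M (\<lambda>\<omega>. ?ind (0, 0, 1) \<omega> * g (real_of_int (Y 3 i \<omega> + Y 4 i \<omega>)))"
    "expectation (\<lambda>\<omega>. ?ind (0, 0, 1) \<omega> * g (real_of_int (Y 3 i \<omega> + Y 4 i \<omega>))) =
      p0 / (p0 + p1 + p2) * expectation (\<lambda>\<omega>. g (real_of_int (Y 3 1 \<omega> + Y 4 1 \<omega>)))"
    using split[OF ind[of 4], of "{(0, 0, 1)}" "\<lambda>(x, y, _). g (real_of_int (x + y))"] int_i E_i
      I_prob[OF i]
    by (simp_all add: source_def)
  let ?G = "\<lambda>\<omega>. ?ind (1, 0, 0) \<omega> * g (real_of_int (Y 1 i \<omega>)) +
      ?ind (0, 0, 1) \<omega> * g (real_of_int (Y 3 i \<omega> + Y 4 i \<omega>)) +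
      ?ind (0, 1, 0) \<omega> * g (real_of_int (Y 2 i \<omega>))"
  have G: "integrable M ?G" "expectation ?G =
      (p1 * expectation (\<lambda>\<omega>. g (real_of_int (Y 1 1 \<omega>))) +
       p0 * expectation (\<lambda>\<omega>. g (real_of_int (Y 3 1 \<omega> + Y 4 1 \<omega>))) +
       p2 * expectation (\<lambda>\<omega>. g (real_of_int (Y 2 1 \<omega>)))) / (p0 + p1 + p2)"
    using t0 t1 t2 by (simp_all add: add_divide_distrib)
  have "random_variable borel (claim i)"
    using indep_vars_claims[of 0] i unfolding indep_vars_def2 by (metis UNIV_I not_one_le_zero)
  then have meas: "random_variable borel (\<lambda>\<omega>. g (claim i \<omega>))"
    using g by measurable
  have eq: "AE \<omega> in M. ?G \<omega> = g (claim i \<omega>)"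
    using I_values[OF i] by eventually_elim (auto simp: claim_def indicator_def)
  show ?thesis
    using integrable_cong_AE[OF borel_measurable_integrable[OF G(1)] meas eq]
      integral_cong_AE[OF borel_measurable_integrable[OF G(1)] meas eq] G
    by argo
qed

section \<open>Transform and moments of the compound sum\<close>

lemma compound_sum_expectation:
  fixes g :: "real \<Rightarrow> real"
  assumes "g \<in> borel_measurable borel" "\<And>n. integrable M (\<lambda>\<omega>. g (\<Sum>i = 1..n. claim i \<omega>))"
  shows "integrable M (\<lambda>\<omega>. g (real_of_int (compound_sum B I Y t \<omega>))) \<and>
    expectation (\<lambda>\<omega>. g (real_of_int (compound_sum B I Y t \<omega>))) =
      (\<Sum>n\<le>t. Bernstein t n (p0 + p1 + p2) * expectation (\<lambda>\<omega>. g (\<Sum>i = 1..n. claim i \<omega>)))"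
  unfolding compound_sum_eq prob_B[symmetric]
  by (rule random_sum_expectation[OF indep_vars_claims B_measurable B_le assms])

lemma indep_vars_claim: "indep_vars (\<lambda>_. borel) claim {1..}"
  using indep_vars_subset[OF indep_vars_claims[of 0], of "{1..}"]
  by (rule iffD1[OF indep_vars_cong, rotated -1]) auto

lemma Y_measurable:
  assumes "k \<in> {1, 2, 3, 4}"
  shows "(\<lambda>\<omega>. real_of_int (Y k 1 \<omega>)) \<in> borel_measurable M"
proof -
  have Y34: "random_variable (count_space UNIV) (\<lambda>\<omega>. (Y 3 1 \<omega>, Y 4 1 \<omega>))"
    and Y12: "random_variable (count_space UNIV) (Y 1 1)" "random_variable (count_space UNIV) (Y 2 1)"
    using iid_vars_imp_measurable[OF Y1_iid, of 1] iid_vars_imp_measurable[OF Y2_iid, of 1]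
      iid_vars_imp_measurable[OF Y34_iid, of 1]
    by simp_all
  from measurable_compose[OF Y34, of "\<lambda>x. real_of_int (fst x)" borel]
    measurable_compose[OF Y34, of "\<lambda>x. real_of_int (snd x)" borel]
    measurable_compose[OF Y12(1), of real_of_int borel]
    measurable_compose[OF Y12(2), of real_of_int borel]
  show ?thesis using assms by auto
qed

lemma compound_sum_laplace_transform:
  assumes z: "z \<ge> 0"
  shows "integrable M (\<lambda>\<omega>. exp (- z * real_of_int (compound_sum B I Y t \<omega>))) \<and>
    expectation (\<lambda>\<omega>. exp (- z * real_of_int (compound_sum B I Y t \<omega>))) =
      (1 - (p0 + p1 + p2) + p1 * expectation (\<lambda>\<omega>. exp (- z * real_of_int (Y 1 1 \<omega>)))
        + p0 * expectation (\<lambda>\<omega>. exp (- z * real_of_int (Y 3 1 \<omega> + Y 4 1 \<omega>)))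
        + p2 * expectation (\<lambda>\<omega>. exp (- z * real_of_int (Y 2 1 \<omega>)))) ^ t"
proof -
  define p where "p = p0 + p1 + p2"
  define m where "m = p1 * expectation (\<lambda>\<omega>. exp (- z * real_of_int (Y 1 1 \<omega>)))
        + p0 * expectation (\<lambda>\<omega>. exp (- z * real_of_int (Y 3 1 \<omega> + Y 4 1 \<omega>)))
        + p2 * expectation (\<lambda>\<omega>. exp (- z * real_of_int (Y 2 1 \<omega>)))"
  have p: "p > 0" using p_range by (simp add: p_def)
  \<comment> \<open>Positivity of the sizes and \<open>z \<ge> 0\<close> keep the exponential below
    1, so the transform needs no moment assumption.\<close>
  have bounded: "integrable M (\<lambda>\<omega>. exp (- z * X \<omega>))"
    if [measurable]: "X \<in> borel_measurable M" and "AE \<omega> in M. X \<omega> > 0" for X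
  proof (rule integrable_const_bound[where B = 1])
    show "AE \<omega> in M. norm (exp (- z * X \<omega>)) \<le> 1"
      using that(2) by eventually_elim (use z in simp)
  qed measurable
  have pos: "AE \<omega> in M. Y 1 1 \<omega> > 0" "AE \<omega> in M. Y 2 1 \<omega> > 0"
    "AE \<omega> in M. Y 3 1 \<omega> > 0" "AE \<omega> in M. Y 4 1 \<omega> > 0"
    by (rule Y_positive; simp)+
  have "AE \<omega> in M. real_of_int (Y 3 1 \<omega> + Y 4 1 \<omega>) > 0"
    using pos(3,4) by eventually_elim simp
  moreover have "(\<lambda>\<omega>. real_of_int (Y 3 1 \<omega> + Y 4 1 \<omega>)) \<in> borel_measurable M"
    using Y_measurable[of 3] Y_measurable[of 4] by simp
  ultimately have int: "integrable M (\<lambda>\<omega>. exp (- z * real_of_int (Y 1 1 \<omega>)))"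
    "integrable M (\<lambda>\<omega>. exp (- z * real_of_int (Y 3 1 \<omega> + Y 4 1 \<omega>)))"
    "integrable M (\<lambda>\<omega>. exp (- z * real_of_int (Y 2 1 \<omega>)))"
    using pos Y_measurable[of 1] Y_measurable[of 2] by (simp_all only: bounded of_int_0_less_iff simp_thms insert_iff)
  have claims: "integrable M (\<lambda>\<omega>. exp (- z * claim i \<omega>))"
    "expectation (\<lambda>\<omega>. exp (- z * claim i \<omega>)) = m / p" if "i \<ge> 1" for i
    using claim_expectation[OF that _ int] by (simp_all add: m_def p_def)
  note sums = iid_sum_exp_expectation[OF indep_vars_claim claims]
  \<comment> \<open>The factor \<open>p ^ n\<close> of the binomial weight cancels the denominator
    and leaves the binomial expansion of \<open>m + (1 - p)\<close>.\<close>
  have "(\<Sum>n\<le>t. Bernstein t n p * (m / p) ^ n) =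
      (\<Sum>n\<le>t. of_nat (t choose n) * m ^ n * (1 - p) ^ (t - n))"
    using p by (intro sum.cong) (simp_all add: Bernstein_def power_divide)
  also have "\<dots> = (m + (1 - p)) ^ t" by (rule binomial_ring[symmetric])
  finally show ?thesis
    using compound_sum_expectation[of "\<lambda>x. exp (- z * x)" t] sums
    by (simp add: p_def m_def algebra_simps)
qed

lemma compound_sum_mean:
  assumes Y: "\<And>k. k \<in> {1, 2, 3, 4} \<Longrightarrow> integrable M (\<lambda>\<omega>. real_of_int (Y k 1 \<omega>))"
  shows "integrable M (\<lambda>\<omega>. real_of_int (compound_sum B I Y t \<omega>)) \<and>
    expectation (\<lambda>\<omega>. real_of_int (compound_sum B I Y t \<omega>)) =
      real t * (p1 * expectation (\<lambda>\<omega>. real_of_int (Y 1 1 \<omega>))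
        + p0 * (expectation (\<lambda>\<omega>. real_of_int (Y 3 1 \<omega>)) + expectation (\<lambda>\<omega>. real_of_int (Y 4 1 \<omega>)))
        + p2 * expectation (\<lambda>\<omega>. real_of_int (Y 2 1 \<omega>)))"
proof -
  define p where "p = p0 + p1 + p2"
  define m where "m = p1 * expectation (\<lambda>\<omega>. real_of_int (Y 1 1 \<omega>))
        + p0 * (expectation (\<lambda>\<omega>. real_of_int (Y 3 1 \<omega>)) + expectation (\<lambda>\<omega>. real_of_int (Y 4 1 \<omega>)))
        + p2 * expectation (\<lambda>\<omega>. real_of_int (Y 2 1 \<omega>))"
  have p: "p > 0" using p_range by (simp add: p_def)
  have claims: "integrable M (claim i)" "expectation (claim i) = m / p" if "i \<ge> 1" for i
    using claim_expectation[OF that, of "\<lambda>x. x"] Y by (simp_all add: m_def p_def)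
  note sums = iid_sum_expectation[of claim, OF claims]
  have "(\<Sum>n\<le>t. Bernstein t n p * (real n * (m / p))) = (\<Sum>n\<le>t. real n * Bernstein t n p) * (m / p)"
    unfolding sum_distrib_right by (intro sum.cong) auto
  also have "\<dots> = real t * m" using p by simp
  finally show ?thesis
    using compound_sum_expectation[of "\<lambda>x. x" t] sums by (simp add: p_def m_def)
qed

lemma compound_sum_second_moment:
  assumes Y2: "\<And>k. k \<in> {1, 2, 3, 4} \<Longrightarrow> integrable M (\<lambda>\<omega>. (real_of_int (Y k 1 \<omega>))\<^sup>2)"
  shows "integrable M (\<lambda>\<omega>. (real_of_int (compound_sum B I Y t \<omega>))\<^sup>2) \<and>
    expectation (\<lambda>\<omega>. (real_of_int (compound_sum B I Y t \<omega>))\<^sup>2) =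
      real t * (p1 * expectation (\<lambda>\<omega>. (real_of_int (Y 1 1 \<omega>))\<^sup>2)
        + p0 * expectation (\<lambda>\<omega>. (real_of_int (Y 3 1 \<omega> + Y 4 1 \<omega>))\<^sup>2)
        + p2 * expectation (\<lambda>\<omega>. (real_of_int (Y 2 1 \<omega>))\<^sup>2))
      + real t * (real t - 1) * (p1 * expectation (\<lambda>\<omega>. real_of_int (Y 1 1 \<omega>))
        + p0 * (expectation (\<lambda>\<omega>. real_of_int (Y 3 1 \<omega>)) + expectation (\<lambda>\<omega>. real_of_int (Y 4 1 \<omega>)))
        + p2 * expectation (\<lambda>\<omega>. real_of_int (Y 2 1 \<omega>)))\<^sup>2"
proof -
  define p where "p = p0 + p1 + p2"
  define m where "m = p1 * expectation (\<lambda>\<omega>. real_of_int (Y 1 1 \<omega>))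
        + p0 * (expectation (\<lambda>\<omega>. real_of_int (Y 3 1 \<omega>)) + expectation (\<lambda>\<omega>. real_of_int (Y 4 1 \<omega>)))
        + p2 * expectation (\<lambda>\<omega>. real_of_int (Y 2 1 \<omega>))"
  define q where "q = p1 * expectation (\<lambda>\<omega>. (real_of_int (Y 1 1 \<omega>))\<^sup>2)
        + p0 * expectation (\<lambda>\<omega>. (real_of_int (Y 3 1 \<omega> + Y 4 1 \<omega>))\<^sup>2)
        + p2 * expectation (\<lambda>\<omega>. (real_of_int (Y 2 1 \<omega>))\<^sup>2)"
  have p: "p > 0" using p_range by (simp add: p_def)
  have Y: "integrable M (\<lambda>\<omega>. real_of_int (Y k 1 \<omega>))" if "k \<in> {1, 2, 3, 4}" for k
    using square_integrable_imp_integrable[OF Y_measurable[OF that] Y2[OF that]] .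
  \<comment> \<open>\<open>Y 3\<close> and \<open>Y 4\<close> may be dependent, so their mixed term
    is dominated by the squares and not factored.\<close>
  have sum_sq: "integrable M (\<lambda>\<omega>. (real_of_int (Y 3 1 \<omega> + Y 4 1 \<omega>))\<^sup>2)"
  proof (rule Bochner_Integration.integrable_bound)
    show "integrable M (\<lambda>\<omega>. 2 * (real_of_int (Y 3 1 \<omega>))\<^sup>2 + 2 * (real_of_int (Y 4 1 \<omega>))\<^sup>2)"
      using Y2 by simp
    show "(\<lambda>\<omega>. (real_of_int (Y 3 1 \<omega> + Y 4 1 \<omega>))\<^sup>2) \<in> borel_measurable M"
      using Y_measurable[of 3] Y_measurable[of 4] by simp
    have "(x + y)\<^sup>2 \<le> 2 * x\<^sup>2 + 2 * y\<^sup>2" for x y :: real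
      using zero_le_power2[of "x - y"] by (simp add: power2_sum power2_diff)
    then show "AE \<omega> in M. norm ((real_of_int (Y 3 1 \<omega> + Y 4 1 \<omega>))\<^sup>2) \<le>
        norm (2 * (real_of_int (Y 3 1 \<omega>))\<^sup>2 + 2 * (real_of_int (Y 4 1 \<omega>))\<^sup>2)"
      by simp
  qed
  have claims: "integrable M (claim i)" "expectation (claim i) = m / p"
    "integrable M (\<lambda>\<omega>. (claim i \<omega>)\<^sup>2)" "expectation (\<lambda>\<omega>. (claim i \<omega>)\<^sup>2) = q / p"
    if "i \<ge> 1" for i
    using claim_expectation[OF that, of "\<lambda>x. x"] claim_expectation[OF that, of "\<lambda>x. x\<^sup>2"] Y Y2 sum_sq
    by (simp_all add: m_def p_def q_def)
  note sums = iid_sum_square_expectation[OF indep_vars_claim claims]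
  \<comment> \<open>The two sums on the right are the binomial factorial moments
    \<open>t * p\<close> and \<open>t * (t - 1) * p * p\<close>, which cancel the
    denominators.\<close>
  have "(\<Sum>n\<le>t. Bernstein t n p * (real n * (q / p) + real n * (real n - 1) * (m / p)\<^sup>2)) =
      (\<Sum>n\<le>t. real n * Bernstein t n p) * (q / p) +
      (\<Sum>n\<le>t. real n * (real n - 1) * Bernstein t n p) * (m / p)\<^sup>2"
    unfolding sum_distrib_right sum.distrib[symmetric]
    by (intro sum.cong) (auto simp: algebra_simps)
  also have "\<dots> = real t * q + real t * (real t - 1) * m\<^sup>2"
    using p by (simp add: power_divide)
  finally show ?thesis
    using compound_sum_expectation[of "\<lambda>x. x\<^sup>2" t] sums by (simp add: p_def m_def q_def)
qed

section \<open>The law of the compound sum on the half-line\<close>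

lemma compound_sum_nonneg: "AE \<omega> in M. 0 \<le> real_of_int (compound_sum B I Y t \<omega>)"
proof -
  \<comment> \<open>The number of terms depends on the sample point, so one null set must serve all
    indices; countability provides it.\<close>
  have "AE \<omega> in M. \<forall>i\<in>{1..}. claim i \<omega> > 0"
    by (subst AE_ball_countable) (auto intro: claim_positive)
  then show ?thesis
    unfolding compound_sum_eq by eventually_elim (rule sum_nonneg, simp add: less_imp_le)
qed

lemma compound_sum_measurable: "(\<lambda>\<omega>. real_of_int (compound_sum B I Y t \<omega>)) \<in> borel_measurable M"
proof -
  have "claim i \<in> borel_measurable M" if "i \<ge> 1" for i
    using indep_vars_claim that by (simp add: indep_vars_def2)
  then have "(\<lambda>\<omega>. \<Sum>i = 1..n. claim i \<omega>) \<in> borel_measurable M" for n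
    by (intro borel_measurable_sum) simp
  from measurable_compose_countable[OF this B_measurable] show ?thesis
    unfolding compound_sum_eq .
qed

text \<open>The definition is an equivalence. One direction says that the law of the sum itself
  lives on the half-line and has transform \<open>L\<close>; the other is uniqueness.\<close>

lemma compound_sum_determined:
  assumes "\<And>z. z \<ge> 0 \<Longrightarrow> expectation (\<lambda>\<omega>. exp (- z * real_of_int (compound_sum B I Y t \<omega>))) = L z"
  shows "determined_by_lst (distr M borel (\<lambda>\<omega>. real_of_int (compound_sum B I Y t \<omega>))) L"
proof -
  let ?N = "distr M borel (\<lambda>\<omega>. real_of_int (compound_sum B I Y t \<omega>))"
  have N: "prob_space ?N" "sets ?N = sets borel" "AE x in ?N. 0 \<le> x"
    using compound_sum_nonneg
    by (simp_all add: prob_space_distr compound_sum_measurable AE_distr_iff)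
  have "laplace_stieltjes ?N z = L z" if "z \<ge> 0" for z
    using assms[OF that] unfolding laplace_stieltjes_def
    by (subst integral_distr[OF compound_sum_measurable]) simp_all
  with N show ?thesis
    unfolding determined_by_lst_def by (metis laplace_stieltjes_unique)
qed

end

theorem corollary4:
  fixes M :: "'a measure" and p0 p1 p2 :: real
    and B :: "nat \<Rightarrow> 'a \<Rightarrow> nat" and I Y :: "nat \<Rightarrow> nat \<Rightarrow> 'a \<Rightarrow> int"
    and S :: "nat \<Rightarrow> 'a \<Rightarrow> real" and E D :: "('a \<Rightarrow> real) \<Rightarrow> real" and p :: real
    and L :: "nat \<Rightarrow> real \<Rightarrow> real" and t :: nat
  defines "p \<equiv> p0 + p1 + p2"
    and "S \<equiv> \<lambda>t \<omega>. real_of_int (compound_sum B I Y t \<omega>)"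
    and "E \<equiv> \<lambda>X. prob_space.expectation M X"
    and "D \<equiv> \<lambda>X. prob_space.variance M X"
    and "L \<equiv> \<lambda>t z. (1 - p + p1 * E (\<lambda>\<omega>. exp (- z * real_of_int (Y 1 1 \<omega>)))
                           + p0 * E (\<lambda>\<omega>. exp (- z * real_of_int (Y 3 1 \<omega> + Y 4 1 \<omega>)))
                           + p2 * E (\<lambda>\<omega>. exp (- z * real_of_int (Y 2 1 \<omega>)))) ^ t"
  assumes "compound_binomial_model M p0 p1 p2 B I Y"
  shows
    "((\<forall>z::real. z \<ge> 0 \<longrightarrow>
         integrable M (\<lambda>\<omega>. exp (- z * S t \<omega>)) \<and> E (\<lambda>\<omega>. exp (- z * S t \<omega>)) = L t z) \<and>
      determined_by_lst (distr M borel (S t)) (L t)) \<and>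
     ((\<forall>k\<in>{1, 2, 3, 4}. integrable M (\<lambda>\<omega>. real_of_int (Y k 1 \<omega>))) \<longrightarrow>
        integrable M (S t) \<and>
        E (S t) = real t * (p1 * E (\<lambda>\<omega>. real_of_int (Y 1 1 \<omega>))
                     + p0 * (E (\<lambda>\<omega>. real_of_int (Y 3 1 \<omega>)) + E (\<lambda>\<omega>. real_of_int (Y 4 1 \<omega>)))
                     + p2 * E (\<lambda>\<omega>. real_of_int (Y 2 1 \<omega>)))) \<and>
     ((\<forall>k\<in>{1, 2, 3, 4}. integrable M (\<lambda>\<omega>. (real_of_int (Y k 1 \<omega>))\<^sup>2)) \<longrightarrow>
        integrable M (\<lambda>\<omega>. (S t \<omega>)\<^sup>2) \<and>
        D (S t) = real t * (p1 * E (\<lambda>\<omega>. (real_of_int (Y 1 1 \<omega>))\<^sup>2)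
                     + p2 * E (\<lambda>\<omega>. (real_of_int (Y 2 1 \<omega>))\<^sup>2)
                     + p0 * E (\<lambda>\<omega>. (real_of_int (Y 3 1 \<omega> + Y 4 1 \<omega>))\<^sup>2)
                     - (p1 * E (\<lambda>\<omega>. real_of_int (Y 1 1 \<omega>))
                        + p0 * (E (\<lambda>\<omega>. real_of_int (Y 3 1 \<omega>)) + E (\<lambda>\<omega>. real_of_int (Y 4 1 \<omega>)))
                        + p2 * E (\<lambda>\<omega>. real_of_int (Y 2 1 \<omega>)))\<^sup>2))"
proof -
  interpret compound_binomial_model M p0 p1 p2 B I Y by fact
  have LT: "integrable M (\<lambda>\<omega>. exp (- z * S t \<omega>)) \<and> E (\<lambda>\<omega>. exp (- z * S t \<omega>)) = L t z" if "z \<ge> 0" for z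
    using compound_sum_laplace_transform[OF that] by (simp add: S_def E_def L_def p_def)
  have det: "determined_by_lst (distr M borel (S t)) (L t)"
    unfolding S_def by (rule compound_sum_determined) (use LT in \<open>simp add: S_def E_def\<close>)
  have mean: "integrable M (S t) \<and> E (S t) = real t * (p1 * E (\<lambda>\<omega>. real_of_int (Y 1 1 \<omega>))
                     + p0 * (E (\<lambda>\<omega>. real_of_int (Y 3 1 \<omega>)) + E (\<lambda>\<omega>. real_of_int (Y 4 1 \<omega>)))
                     + p2 * E (\<lambda>\<omega>. real_of_int (Y 2 1 \<omega>)))"
    if "\<forall>k\<in>{1, 2, 3, 4}. integrable M (\<lambda>\<omega>. real_of_int (Y k 1 \<omega>))"
    unfolding S_def E_def by (rule compound_sum_mean) (use that in blast)
  have var: "integrable M (\<lambda>\<omega>. (S t \<omega>)\<^sup>2) \<and>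
        D (S t) = real t * (p1 * E (\<lambda>\<omega>. (real_of_int (Y 1 1 \<omega>))\<^sup>2)
                     + p2 * E (\<lambda>\<omega>. (real_of_int (Y 2 1 \<omega>))\<^sup>2)
                     + p0 * E (\<lambda>\<omega>. (real_of_int (Y 3 1 \<omega> + Y 4 1 \<omega>))\<^sup>2)
                     - (p1 * E (\<lambda>\<omega>. real_of_int (Y 1 1 \<omega>))
                        + p0 * (E (\<lambda>\<omega>. real_of_int (Y 3 1 \<omega>)) + E (\<lambda>\<omega>. real_of_int (Y 4 1 \<omega>)))
                        + p2 * E (\<lambda>\<omega>. real_of_int (Y 2 1 \<omega>)))\<^sup>2)"
    if sq: "\<forall>k\<in>{1, 2, 3, 4}. integrable M (\<lambda>\<omega>. (real_of_int (Y k 1 \<omega>))\<^sup>2)"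
  proof -
    \<comment> \<open>On a probability space square integrability implies integrability, which makes
      the mean formula available.\<close>
    have "integrable M (\<lambda>\<omega>. real_of_int (Y k 1 \<omega>))" if "k \<in> {1, 2, 3, 4}" for k
      by (rule square_integrable_imp_integrable)
        (use sq that Y_measurable in blast)+
    then have m: "integrable M (S t) \<and> E (S t) = real t * (p1 * E (\<lambda>\<omega>. real_of_int (Y 1 1 \<omega>))
                     + p0 * (E (\<lambda>\<omega>. real_of_int (Y 3 1 \<omega>)) + E (\<lambda>\<omega>. real_of_int (Y 4 1 \<omega>)))
                     + p2 * E (\<lambda>\<omega>. real_of_int (Y 2 1 \<omega>)))"
      using mean by blast
    have q: "integrable M (\<lambda>\<omega>. (S t \<omega>)\<^sup>2) \<and> E (\<lambda>\<omega>. (S t \<omega>)\<^sup>2) =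
      real t * (p1 * E (\<lambda>\<omega>. (real_of_int (Y 1 1 \<omega>))\<^sup>2)
        + p0 * E (\<lambda>\<omega>. (real_of_int (Y 3 1 \<omega> + Y 4 1 \<omega>))\<^sup>2)
        + p2 * E (\<lambda>\<omega>. (real_of_int (Y 2 1 \<omega>))\<^sup>2))
      + real t * (real t - 1) * (p1 * E (\<lambda>\<omega>. real_of_int (Y 1 1 \<omega>))
        + p0 * (E (\<lambda>\<omega>. real_of_int (Y 3 1 \<omega>)) + E (\<lambda>\<omega>. real_of_int (Y 4 1 \<omega>)))
        + p2 * E (\<lambda>\<omega>. real_of_int (Y 2 1 \<omega>)))\<^sup>2"
      unfolding S_def E_def by (rule compound_sum_second_moment) (use sq in blast)
    \<comment> \<open>With \<open>x\<close> the time and \<open>y\<close> the mean per step, the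
      terms quadratic in \<open>x\<close> cancel, which is why the variance is linear in
      time.\<close>
    have algebra: "x * (a + b + c) + x * (x - 1) * y\<^sup>2 - (x * y)\<^sup>2 = x * (a + c + b - y\<^sup>2)"
      for x a b c y :: real
      by (simp add: power2_eq_square algebra_simps)
    have "D (S t) = E (\<lambda>\<omega>. (S t \<omega>)\<^sup>2) - (E (S t))\<^sup>2"
      unfolding D_def E_def using m q by (intro variance_eq) auto
    then show ?thesis
      unfolding q[THEN conjunct2] m[THEN conjunct2] algebra using q by blast
  qed
  show ?thesis using LT det mean var by blast
qed

end
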